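(* Let $d\ge1$ and $f_t\in\mathcal{R}_d[t_1,\dots,t_n]$, and let $f_0\in\mathcal{R}_d$ be its value at $t_1=\dots=t_n=0$. Then $$\dim_{K(t_1,\dots,t_n)}M_{f_t}\le\dim_KM_{f_0}.$$ In particular, if $f_t$ splits regularly $m$ times (over $K(t_1,\dots,t_n)$), then $m\le\dim_KM_{f_0}-1$.
   Context: $K$ is a field, $r\ge 1$, $R=K[\partial_1,\dots,\partial_r]$ is a polynomial ring with the standard grading, and $\mathcal{R}=K[x_1,\dots,x_r]^{DP}=\bigoplus_{d\ge0}\mathcal{R}_d$ is the divided power ring: $\mathcal{R}_d$ has $K$-basis $x^{(\alpha)}=\prod_i x_i^{(\alpha_i)}$, $|\alpha|=d$, with multiplication generated by $x_i^{(a)}x_i^{(b)}=\binom{a+b}{a}x_i^{(a+b)}$. $R$ acts on $\mathcal{R}$ by $\partial^\beta(x^{(\alpha)})=x^{(\alpha-\beta)}$ (zero if some $\alpha_i<\beta_i$). $\mathcal{R}_d[t_1,\dots,t_n]=\mathcal{R}_d\otimes_KK[t_1,\dots,t_n]$, regarded inside $\mathcal{R}_d(t_1,\dots,t_n)=\mathcal{R}_d\otimes_KK(t_1,\dots,t_n)$, i.e. the degree $d$ forms of the divided power ring over $K(t_1,\dots,t_n)$; the same definitions below apply over the field $K(t_1,\dots,t_n)$ with $R(t_1,\dots,t_n)=R\otimes_KK(t_1,\dots,t_n)$. For $f\in\mathcal{R}_d$: $\mathrm{ann}_R(f)=\{D\in R:Df=0\}$, $R_e(f)=\{Df:D\in R_e\}$,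 $\partial=[\partial_1,\dots,\partial_r]^T$, and $$M_f=\{A\in\mathrm{Mat}_K(r,r):I_2(\partial\;A\partial)\subseteq\mathrm{ann}_R(f)\},$$ where $I_2(\partial\;A\partial)$ is the ideal generated by the $2\times2$ minors of the $r\times2$ matrix with columns $\partial$ and $A\partial$. Thus $M_{f_t}=\{A\in\mathrm{Mat}_{K(t_1,\dots,t_n)}(r,r):I_2(\partial\;A\partial)\subseteq\mathrm{ann}_{R(t_1,\dots,t_n)}(f_t)\}$. A form $f$ of degree $d$ splits regularly $m$ times if $f=g_1+\dots+g_{m+1}$ with nonzero forms $g_i$ of degree $d$ such that $R_{d-1}(g_i)\cap\sum_{j\ne i}R_{d-1}(g_j)=0$ for all $i$. *)

theory Defs
  imports
    "HOL-Analysis.Determinants"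
    "HOL-Library.Poly_Mapping"
    "HOL-Computational_Algebra.Fraction_Field"
begin

text \<open>
  A monomial in variables indexed by the finite (hence nonempty) type \<open>'r\<close> is an
  exponent vector in \<open>'r \<Rightarrow>\<^sub>0 nat\<close>, and \<open>K[\<partial>\<^sub>1,\<dots>,\<partial>\<^sub>r]\<close> is the convolution ring of finitely
  supported functions on exponent vectors.

  The divided power ring is represented by the same type: \<open>f :: ('r, 'a) dpring\<close> stands for
  \<open>\<Sum>\<alpha>. lookup f \<alpha> \<cdot> x\<^sup>(\<^sup>\<alpha>\<^sup>)\<close>.  Only its structure as a graded module over \<open>K[\<partial>\<^sub>1,\<dots>,\<partial>\<^sub>r]\<close>, given by
  \<open>act\<close> below, is used here.  In particular \<open>(*)\<close> on this type is the product of polynomials, not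
  that of divided powers, and is never applied to elements of \<open>dpring\<close>.
\<close>

type_synonym ('r, 'a) mpoly = "('r \<Rightarrow>\<^sub>0 nat) \<Rightarrow>\<^sub>0 'a"
type_synonym ('r, 'a) dpring = "('r \<Rightarrow>\<^sub>0 nat) \<Rightarrow>\<^sub>0 'a"

definition forms :: "nat \<Rightarrow> (('r::finite \<Rightarrow>\<^sub>0 nat) \<Rightarrow>\<^sub>0 'a::zero) set" where
  "forms d = {f. \<forall>\<alpha>\<in>Poly_Mapping.keys f. (\<Sum>i\<in>UNIV. Poly_Mapping.lookup \<alpha> i) = d}"

text \<open>
  Divisibility of monomials is written out, because \<open>\<le>\<close> on \<open>'r \<Rightarrow>\<^sub>0 nat\<close> is a lexicographic order.
\<close>

definition act_monom ::
    "('r \<Rightarrow>\<^sub>0 nat) \<Rightarrow> ('r \<Rightarrow>\<^sub>0 nat) \<Rightarrow> ('r, 'a::comm_ring_1) dpring" where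
  "act_monom \<beta> \<alpha> =
     (if \<forall>i. Poly_Mapping.lookup \<beta> i \<le> Poly_Mapping.lookup \<alpha> i
      then Poly_Mapping.single (\<alpha> - \<beta>) 1 else 0)"

definition dp_scale :: "'a::comm_ring_1 \<Rightarrow> ('r, 'a) dpring \<Rightarrow> ('r, 'a) dpring" where
  "dp_scale c f = Poly_Mapping.map (\<lambda>a. c * a) f"

definition act :: "('r, 'a::comm_ring_1) mpoly \<Rightarrow> ('r, 'a) dpring \<Rightarrow> ('r, 'a) dpring" where
  "act D f =
     (\<Sum>\<beta>\<in>Poly_Mapping.keys D. \<Sum>\<alpha>\<in>Poly_Mapping.keys f.
        dp_scale (Poly_Mapping.lookup D \<beta> * Poly_Mapping.lookup f \<alpha>) (act_monom \<beta> \<alpha>))"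

definition ann :: "('r, 'a::comm_ring_1) dpring \<Rightarrow> ('r, 'a) mpoly set" where
  "ann f = {D. act D f = 0}"

definition derivs :: "nat \<Rightarrow> ('r::finite, 'a::comm_ring_1) dpring \<Rightarrow> ('r, 'a) dpring set" where
  "derivs e f = {act D f | D. D \<in> forms e}"

definition del :: "('r::finite, 'a::comm_ring_1) mpoly ^ 'r" where
  "del = (\<chi> i. Poly_Mapping.single (Poly_Mapping.single i 1) 1)"

definition const_matrix :: "'a::comm_ring_1 ^ 'r ^ 'r \<Rightarrow> ('r::finite, 'a) mpoly ^ 'r ^ 'r" where
  "const_matrix A = (\<chi> i j. Poly_Mapping.single 0 (A $ i $ j))"

definition two_columns :: "'p ^ 'r \<Rightarrow> 'p ^ 'r \<Rightarrow> 'p ^ 2 ^ 'r::finite" where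
  "two_columns u v = (\<chi> i k. if k = 1 then u $ i else v $ i)"

text \<open>
  The ideal generated by a set is its span in the ring as a module over itself.
\<close>

definition minors_ideal :: "'p::comm_ring_1 ^ 2 ^ 'r::finite \<Rightarrow> 'p set" where
  "minors_ideal N =
     module.span (*) {N $ i $ 1 * N $ j $ 2 - N $ i $ 2 * N $ j $ 1 | i j. True}"

definition M_set :: "('r::finite, 'a::comm_ring_1) dpring \<Rightarrow> ('a ^ 'r ^ 'r) set" where
  "M_set f = {A. minors_ideal (two_columns del (const_matrix A *v del)) \<subseteq> ann f}"

definition mat_scale :: "'a::comm_ring_1 \<Rightarrow> 'a ^ 'r ^ 'r \<Rightarrow> 'a ^ 'r ^ 'r::finite" where
  "mat_scale c A = (\<chi> i j. c * A $ i $ j)"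

lemma vector_space_mat_scale: "vector_space (mat_scale :: 'a::field \<Rightarrow> 'a ^ 'r ^ 'r::finite \<Rightarrow> _)"
  by standard (auto simp: mat_scale_def vec_eq_iff algebra_simps)

definition mat_dim :: "('a::field ^ 'r ^ 'r::finite) set \<Rightarrow> nat" where
  "mat_dim V = vector_space.dim mat_scale V"

definition splits_regularly ::
    "nat \<Rightarrow> nat \<Rightarrow> ('r::finite, 'a::field) dpring \<Rightarrow> bool" where
  "splits_regularly d m f \<longleftrightarrow>
     (\<exists>g. f = (\<Sum>i\<in>{1..m+1}. g i) \<and>
          (\<forall>i\<in>{1..m+1}. g i \<in> forms d \<and> g i \<noteq> 0 \<and>
             derivs (d - 1) (g i) \<inter>
               {\<Sum>j\<in>{1..m+1} - {i}. h j | h. \<forall>j\<in>{1..m+1} - {i}. h j \<in> derivs (d - 1) (g j)}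
             = {0}))"

text \<open>
  An element of \<open>\<R>\<^sub>d[t\<^sub>1,\<dots>,t\<^sub>n]\<close> is a form with coefficients in \<open>K[t\<^sub>1,\<dots>,t\<^sub>n]\<close>; the parameters are
  indexed by the finite type \<open>'n\<close>.  The type needs some linear order only because the library's
  proof that the polynomial ring is a domain uses one.
\<close>

definition generic_form ::
    "('r, ('n::{finite,linorder}, 'k::field) mpoly) dpring \<Rightarrow> ('r, ('n, 'k) mpoly fract) dpring" where
  "generic_form f = Poly_Mapping.map (\<lambda>p. Fraction_Field.Fract p 1) f"

definition eval_at :: "('n \<Rightarrow> 'k) \<Rightarrow> ('n::finite, 'k::comm_ring_1) mpoly \<Rightarrow> 'k" where
  "eval_at a p =
     (\<Sum>\<beta>\<in>Poly_Mapping.keys p. Poly_Mapping.lookup p \<beta> * (\<Prod>i\<in>UNIV. a i ^ Poly_Mapping.lookup \<beta> i))"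

definition specialize ::
    "('n \<Rightarrow> 'k) \<Rightarrow> ('r, ('n::finite, 'k::comm_ring_1) mpoly) dpring \<Rightarrow> ('r, 'k) dpring" where
  "specialize a f = Poly_Mapping.map (eval_at a) f"

end

theory Submission
  imports Defs
begin

text \<open>
  Comparing coefficients turns membership \<open>A \<in> M\<^sub>f\<close> into homogeneous linear equations in the
  entries of \<open>A\<close>, whose coefficients are coefficients of \<open>f\<close> (\<open>mem_M_set_iff\<close>).  Hence
  \<open>M\<close> of the generic form is the solution space of a system over \<open>K[t]\<close>, and \<open>M\<close> of the special
  form that of the same system at \<open>t = 0\<close>.

  Semicontinuity comes from lowest-degree terms.  If a matrix with entries in \<open>K[t]\<close> solves the generic
  system, its coefficient matrix at a monomial of lowest total degree solves the special one, because
  in that degree only the constant terms of the equations contribute.  Choose matrix entries, no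
  more than the dimension of the special solution space, so that a special solution vanishing there is zero.
  If the generic space had larger dimension, it would contain a nonzero \<open>A\<close> vanishing at these
  entries; after clearing denominators, the lowest-degree coefficient matrix of \<open>A\<close> would be a nonzero
  special solution vanishing there, which is absurd (\<open>dim_M_set_generic_le\<close>).

  For the second assertion let \<open>f = \<Sum>g\<^sub>i\<close> be a regular splitting and let \<open>V\<^sub>i\<close> be the space of linear
  forms \<open>R\<^sub>d\<^sub>-\<^sub>1(g\<^sub>i)\<close>.  These spaces are nonzero and independent, so there is a matrix \<open>A\<^sub>i\<close> that is
  the identity on \<open>V\<^sub>i\<close> and zero on the other \<open>V\<^sub>j\<close>.  The derivatives of order \<open>d - 1\<close> of \<open>g\<^sub>j\<close> lie in
  \<open>V\<^sub>j\<close>, so \<open>(A\<^sub>i\<partial>)f = \<partial>g\<^sub>i\<close>, and the minors of \<open>(\<partial>  A\<^sub>i\<partial>)\<close> kill \<open>f\<close> by symmetry of second derivatives.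
  The \<open>A\<^sub>i\<close> are linearly independent elements of \<open>M\<^sub>f\<close>, one for each summand
  (\<open>card_le_dim_M_set_of_splitting\<close>).  Applied over \<open>K(t)\<close>, this and semicontinuity give the bound.
\<close>

section \<open>Coordinates separating the points of a subspace\<close>

context finite_dimensional_vector_space
begin

lemma subspace_Int_kernel:
  assumes "subspace V" "Vector_Spaces.linear scale (*) \<phi>"
  shows "subspace (V \<inter> {x. \<phi> x = 0})"
proof -
  interpret \<phi>: Vector_Spaces.linear scale "(*)" \<phi> by fact
  show ?thesis using assms(1) by (simp add: subspace_def \<phi>.add \<phi>.scale)
qed

text \<open>
  Each functional that is nonzero somewhere on \<open>V\<close> cuts the dimension by at least one, so the
  choice stops after at most \<open>dim V\<close> steps.
\<close>

lemma ex_separating_functionals: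
  assumes "subspace V"
    and "\<And>k. k \<in> I \<Longrightarrow> Vector_Spaces.linear scale (*) (\<phi> k)"
    and "\<And>x. x \<in> V \<Longrightarrow> (\<And>k. k \<in> I \<Longrightarrow> \<phi> k x = 0) \<Longrightarrow> x = 0"
  shows "\<exists>P\<subseteq>I. finite P \<and> card P \<le> dim V \<and> (\<forall>x\<in>V. (\<forall>k\<in>P. \<phi> k x = 0) \<longrightarrow> x = 0)"
  using assms(1,3)
proof (induction "dim V" arbitrary: V rule: less_induct)
  case less
  show ?case
  proof (cases "V \<subseteq> {0}")
    case True
    then show ?thesis by (intro exI[of _ "{}"]) auto
  next
    case False
    then obtain v where v: "v \<in> V" "v \<noteq> 0" by auto
    with less.prems(2) obtain k where k: "k \<in> I" "\<phi> k v \<noteq> 0" by blast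
    define W where "W = V \<inter> {x. \<phi> k x = 0}"
    have W: "subspace W"
      unfolding W_def using less.prems(1) assms(2)[OF k(1)] by (rule subspace_Int_kernel)
    have "W \<subset> V" unfolding W_def using v k by auto
    then have lt: "dim W < dim V"
      using W less.prems(1) by (intro dim_psubset) (simp add: span_eq_iff[THEN iffD2])
    obtain P where P: "P \<subseteq> I" "finite P" "card P \<le> dim W"
        "\<forall>x\<in>W. (\<forall>k\<in>P. \<phi> k x = 0) \<longrightarrow> x = 0"
      using less.hyps[OF lt W] less.prems(2) unfolding W_def by blast
    show ?thesis
    proof (intro exI[of _ "insert k P"] conjI)
      show "card (insert k P) \<le> dim V"
        using P(2,3) lt by (simp add: card_insert_if)
    qed (use P k in \<open>auto simp: W_def\<close>)
  qed
qed

text \<open>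
  Converse to the preceding lemma: imposing one linear equation lowers the dimension by at most one.
\<close>

lemma dim_le_card_separating_functionals:
  assumes "finite P" "subspace V"
    and "\<And>k. k \<in> P \<Longrightarrow> Vector_Spaces.linear scale (*) (\<phi> k)"
    and "\<And>x. x \<in> V \<Longrightarrow> (\<And>k. k \<in> P \<Longrightarrow> \<phi> k x = 0) \<Longrightarrow> x = 0"
  shows "dim V \<le> card P"
  using assms
proof (induction P arbitrary: V rule: finite_induct)
  case empty
  then show ?case by (auto simp: dim_eq_0)
next
  case (insert k P)
  interpret \<phi>: Vector_Spaces.linear scale "(*)" "\<phi> k" using insert.prems(2) by simp
  define W where "W = V \<inter> {x. \<phi> k x = 0}"
  have "subspace W"
    unfolding W_def using insert.prems by (intro subspace_Int_kernel) auto
  then have W: "dim W \<le> card P"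
    by (rule insert.IH) (use insert.prems in \<open>auto simp: W_def\<close>)
  show ?case
  proof (cases "V \<subseteq> W")
    case True
    then show ?thesis using W dim_subset[of V W] insert.hyps by simp
  next
    case False
    then obtain v where v: "v \<in> V" "\<phi> k v \<noteq> 0" by (auto simp: W_def)
    have "V \<subseteq> span (insert v W)"
    proof
      fix x assume "x \<in> V"
      define c where "c = \<phi> k x / \<phi> k v"
      have "x - scale c v \<in> W"
        using \<open>x \<in> V\<close> v insert.prems(1)
        by (auto simp: W_def c_def \<phi>.diff \<phi>.scale intro: subspace_diff subspace_scale)
      then show "x \<in> span (insert v W)"
        by (auto simp: span_breakdown_eq intro: span_base)
    qed
    then have "dim V \<le> dim (insert v W)"
      by (metis dim_span dim_subset)
    also have "\<dots> \<le> Suc (dim W)" by (simp add: dim_insert)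
    finally show ?thesis using W insert.hyps by simp
  qed
qed

end

section \<open>Matrices as a finite-dimensional space\<close>

lemma obtain_mat_basis:
  obtains B :: "('a::field ^ 'r ^ 'r::finite) set"
  where "finite_dimensional_vector_space mat_scale B"
proof -
  interpret vector_space "mat_scale :: 'a \<Rightarrow> 'a ^ 'r ^ 'r \<Rightarrow> _" by (rule vector_space_mat_scale)
  \<comment> \<open>The matrix units span; a basis is selected among them.\<close>
  define E :: "'r \<times> 'r \<Rightarrow> 'a ^ 'r ^ 'r" where "E = (\<lambda>(i, j). axis i (axis j 1))"
  have "A \<in> span (range E)" for A
  proof -
    have "A = (\<Sum>(i, j)\<in>UNIV. mat_scale (A $ i $ j) (E (i, j)))"
    proof -
      have "(\<Sum>(i, j)\<in>UNIV. mat_scale (A $ i $ j) (E (i, j))) $ a $ b = A $ a $ b" for a b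
      proof -
        have "(\<Sum>(i, j)\<in>UNIV. mat_scale (A $ i $ j) (E (i, j))) $ a $ b
            = (\<Sum>p\<in>UNIV. if p = (a, b) then A $ a $ b else 0)"
          unfolding sum_component
          by (rule sum.cong) (auto simp: mat_scale_def E_def axis_def split: if_splits)
        then show ?thesis by simp
      qed
      then show ?thesis by (simp add: vec_eq_iff)
    qed
    also have "\<dots> \<in> span (range E)"
      by (intro span_sum) (auto intro: span_scale span_base)
    finally show ?thesis .
  qed
  then have span: "span (range E) = UNIV" by auto
  obtain B where B: "B \<subseteq> range E" "independent B" "range E \<subseteq> span B"
    by (rule maximal_independent_subset)
  show thesis
  proof (rule that, unfold_locales)
    show "finite B" by (rule finite_subset[OF B(1)]) simp
    show "span B = UNIV" using B(3) span by (metis span_mono span_span top.extremum_uniqueI)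
  qed (rule B(2))
qed

lemma mat_eq_0I: "(\<And>k. A $ fst k $ snd k = 0) \<Longrightarrow> A = 0"
  by (metis fst_conv snd_conv vec_eq_iff zero_index)

lemma linear_mat_entry: "Vector_Spaces.linear mat_scale (*) (\<lambda>A :: 'a::field ^ 'r ^ 'r::finite. A $ i $ j)"
  by (auto simp: Vector_Spaces.linear_iff vector_space_mat_scale mat_scale_def
      vector_space_over_itself.vector_space_axioms)

section \<open>The action on divided powers\<close>

abbreviation unit_exp :: "'r \<Rightarrow> 'r \<Rightarrow>\<^sub>0 nat" where
  "unit_exp i \<equiv> Poly_Mapping.single i 1"

abbreviation total_degree :: "('r::finite \<Rightarrow>\<^sub>0 nat) \<Rightarrow> nat" where
  "total_degree \<alpha> \<equiv> \<Sum>i\<in>UNIV. Poly_Mapping.lookup \<alpha> i"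

lemma total_degree_add: "total_degree (\<alpha> + \<beta>) = total_degree \<alpha> + total_degree \<beta>"
  by (simp add: lookup_add sum.distrib)

lemma total_degree_unit_exp: "total_degree (unit_exp i) = 1"
  by (simp add: lookup_single when_def)

lemma lookup_dp_scale: "Poly_Mapping.lookup (dp_scale c f) \<gamma> = c * Poly_Mapping.lookup f \<gamma>"
  by (simp add: dp_scale_def map.rep_eq when_def)

lemma lookup_act_monom:
  "Poly_Mapping.lookup (act_monom \<beta> \<alpha>) \<gamma> = (if \<alpha> = \<gamma> + \<beta> then 1 else 0)"
proof -
  have "(\<forall>i. Poly_Mapping.lookup \<beta> i \<le> Poly_Mapping.lookup \<alpha> i) \<and> \<alpha> - \<beta> = \<gamma> \<longleftrightarrow> \<alpha> = \<gamma> + \<beta>"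
    by (auto simp: poly_mapping_eq_iff fun_eq_iff lookup_add lookup_minus) (metis add.commute le_add_diff_inverse)
  then show ?thesis by (auto simp: act_monom_def lookup_single when_def)
qed

text \<open>
  All later arguments use this closed form of the contraction action; there is no case distinction
  on divisibility left, since \<open>\<gamma> + \<beta>\<close> is the only exponent that \<open>\<partial>\<^sup>\<beta>\<close> sends to \<open>\<gamma>\<close>.
\<close>

lemma lookup_act:
  "Poly_Mapping.lookup (act D f) \<gamma> =
    (\<Sum>\<beta>\<in>Poly_Mapping.keys D. Poly_Mapping.lookup D \<beta> * Poly_Mapping.lookup f (\<gamma> + \<beta>))"
proof -
  have "(\<Sum>\<alpha>\<in>Poly_Mapping.keys f. Poly_Mapping.lookup D \<beta> * Poly_Mapping.lookup f \<alpha> *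
      (if \<alpha> = \<gamma> + \<beta> then 1 else 0)) = Poly_Mapping.lookup D \<beta> * Poly_Mapping.lookup f (\<gamma> + \<beta>)" for \<beta>
    by (simp add: if_distrib[of "(*) _"] in_keys_iff cong: if_cong)
  then show ?thesis
    by (simp add: act_def lookup_sum lookup_dp_scale lookup_act_monom)
qed

lemma lookup_act_superset:
  assumes "finite S" "Poly_Mapping.keys D \<subseteq> S"
  shows "Poly_Mapping.lookup (act D f) \<gamma> =
    (\<Sum>\<beta>\<in>S. Poly_Mapping.lookup D \<beta> * Poly_Mapping.lookup f (\<gamma> + \<beta>))"
  unfolding lookup_act using assms
  by (intro sum.mono_neutral_left) (auto simp: in_keys_iff)

lemma lookup_act_single:
  "Poly_Mapping.lookup (act (Poly_Mapping.single \<beta> c) f) \<gamma> = c * Poly_Mapping.lookup f (\<gamma> + \<beta>)"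
  by (subst lookup_act_superset[of "{\<beta>}"]) auto

lemma act_add: "act (D + E) f = act D f + act E f"
  by (rule poly_mapping_eqI)
    (use keys_add[of D E] in \<open>simp add: lookup_add sum.distrib algebra_simps
      lookup_act_superset[of "Poly_Mapping.keys D \<union> Poly_Mapping.keys E"]\<close>)

lemma act_zero: "act 0 f = 0"
  by (simp add: act_def)

lemma act_sum: "act (\<Sum>i\<in>I. D i) f = (\<Sum>i\<in>I. act (D i) f)"
  by (induction I rule: infinite_finite_induct) (auto simp: act_zero act_add)

lemma act_diff: "act (D - E) f = act D f - act E f"
  using act_add[of "D - E" E f] by (simp add: algebra_simps)

lemma act_add_right: "act D (f + g) = act D f + act D g"
  by (rule poly_mapping_eqI) (simp add: lookup_act lookup_add sum.distrib algebra_simps)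

lemma act_zero_right: "act D 0 = 0"
  by (simp add: act_def)

lemma act_sum_right: "act D (\<Sum>i\<in>I. f i) = (\<Sum>i\<in>I. act D (f i))"
  by (induction I rule: infinite_finite_induct) (auto simp: act_zero_right act_add_right)

lemma sum_of_terms:
  "D = (\<Sum>\<beta>\<in>Poly_Mapping.keys D. Poly_Mapping.single \<beta> (Poly_Mapping.lookup D \<beta>))"
  by (rule poly_mapping_eqI) (simp add: lookup_sum lookup_single when_def in_keys_iff)

text \<open>
  Divided powers form a module over the polynomial ring, so annihilators are ideals and can be tested
  on generators.
\<close>

lemma act_mult: "act (D * E) f = act D (act E f)"
proof -
  have monom: "act (Poly_Mapping.single \<beta> c * Poly_Mapping.single \<beta>' c') f
      = act (Poly_Mapping.single \<beta> c) (act (Poly_Mapping.single \<beta>' c') f)" for \<beta> c \<beta>' c'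
    by (rule poly_mapping_eqI) (simp add: mult_single lookup_act_single algebra_simps)
  have "act (Poly_Mapping.single \<beta> c * E) f = act (Poly_Mapping.single \<beta> c) (act E f)" for \<beta> c
    by (subst (1 2) sum_of_terms[of E])
      (simp only: sum_distrib_left act_sum act_sum_right monom)
  then show ?thesis
    by (subst (1 2) sum_of_terms[of D]) (simp only: sum_distrib_right act_sum)
qed

section \<open>Linear equations for the matrix space of a form\<close>

lemma module_mult: "module ((*) :: 'p::comm_ring_1 \<Rightarrow> 'p \<Rightarrow> 'p)"
  by unfold_locales (simp_all add: algebra_simps)

lemma minors_ideal_subset_ann_iff:
  "minors_ideal N \<subseteq> ann f \<longleftrightarrow>
    (\<forall>i j. act (N $ i $ 1 * N $ j $ 2 - N $ i $ 2 * N $ j $ 1) f = 0)"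
proof -
  interpret module "(*) :: ('a, 'b) mpoly \<Rightarrow> _" by (rule module_mult)
  have "subspace (ann f)"
    by (simp add: subspace_def ann_def act_zero act_add act_mult act_zero_right)
  then have "span G \<subseteq> ann f \<longleftrightarrow> G \<subseteq> ann f" for G
    using span_minimal[of G "ann f"] span_superset[of G] by blast
  then show ?thesis
    by (auto simp: minors_ideal_def ann_def subset_iff)
qed

lemma lookup_act_const_matrix_del:
  "Poly_Mapping.lookup (act ((const_matrix A *v del) $ j) f) \<gamma> =
    (\<Sum>k\<in>UNIV. A $ j $ k * Poly_Mapping.lookup f (\<gamma> + unit_exp k))"
  by (simp add: matrix_vector_mult_def const_matrix_def del_def mult_single act_sum lookup_sum
      lookup_act_single)

lemma lookup_act_del_mult:
  "Poly_Mapping.lookup (act (del $ i * D) f) \<gamma> = Poly_Mapping.lookup (act D f) (\<gamma> + unit_exp i)"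
  by (simp add: act_mult del_def lookup_act_single)

text \<open>
  The two sides are the coefficients at \<open>\<gamma>\<close> of \<open>\<partial>\<^sub>i(A\<partial>)\<^sub>jf\<close> and \<open>\<partial>\<^sub>j(A\<partial>)\<^sub>if\<close>.  The coefficients of the
  equations are themselves coefficients of \<open>f\<close>, which is what makes the system specialize with \<open>f\<close>.
\<close>

lemma mem_M_set_iff:
  "A \<in> M_set f \<longleftrightarrow> (\<forall>i j \<gamma>.
    (\<Sum>k\<in>UNIV. A $ j $ k * Poly_Mapping.lookup f (\<gamma> + unit_exp i + unit_exp k)) =
    (\<Sum>k\<in>UNIV. A $ i $ k * Poly_Mapping.lookup f (\<gamma> + unit_exp j + unit_exp k)))"
proof -
  have "act (del $ i * (const_matrix A *v del) $ j - (const_matrix A *v del) $ i * del $ j) f = 0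
    \<longleftrightarrow> (\<forall>\<gamma>. (\<Sum>k\<in>UNIV. A $ j $ k * Poly_Mapping.lookup f (\<gamma> + unit_exp i + unit_exp k)) =
      (\<Sum>k\<in>UNIV. A $ i $ k * Poly_Mapping.lookup f (\<gamma> + unit_exp j + unit_exp k)))" for i j
    by (simp add: mult.commute[of _ "del $ j"] act_diff poly_mapping_eq_iff[of "act _ _"] fun_eq_iff
        lookup_act_del_mult lookup_act_const_matrix_del)
  then show ?thesis
    by (simp add: M_set_def minors_ideal_subset_ann_iff two_columns_def)
qed

lemma subspace_M_set: "module.subspace mat_scale (M_set f)" for f :: "('r::finite, 'a::field) dpring"
proof -
  interpret vector_space "mat_scale :: 'a \<Rightarrow> 'a ^ 'r ^ 'r \<Rightarrow> _" by (rule vector_space_mat_scale)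
  show ?thesis
    by (auto simp: subspace_def mem_M_set_iff mat_scale_def distrib_right sum.distrib mult.assoc
        simp flip: sum_distrib_left)
qed

section \<open>Semicontinuity under specialization\<close>

lemma lookup_generic_form:
  "Poly_Mapping.lookup (generic_form f) \<alpha> = Fraction_Field.Fract (Poly_Mapping.lookup f \<alpha>) 1"
  by (simp add: generic_form_def map.rep_eq when_def fract_collapse)

lemma eval_at_zero: "eval_at (\<lambda>_. 0) p = Poly_Mapping.lookup p 0" for p :: "('n::finite, 'k::comm_ring_1) mpoly"
proof -
  have "(\<Prod>i\<in>UNIV. (0::'k) ^ Poly_Mapping.lookup \<beta> i) = (if \<beta> = 0 then 1 else 0)"
    for \<beta> :: "'n \<Rightarrow>\<^sub>0 nat"
  proof (cases "\<beta> = 0")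
    case False
    then obtain i where "Poly_Mapping.lookup \<beta> i \<noteq> 0"
      by (metis lookup_zero poly_mapping_eqI)
    then have "(0::'k) ^ Poly_Mapping.lookup \<beta> i = 0" by (simp add: zero_power)
    then have "(\<Prod>i\<in>UNIV. (0::'k) ^ Poly_Mapping.lookup \<beta> i) = 0"
      by (intro prod_zero bexI[of _ i]) simp_all
    with False show ?thesis by simp
  qed simp
  then show ?thesis
    by (simp add: eval_at_def if_distrib[of "(*) _"] in_keys_iff cong: if_cong)
qed

lemma lookup_specialize_zero:
  "Poly_Mapping.lookup (specialize (\<lambda>_. 0) f) \<alpha> = Poly_Mapping.lookup (Poly_Mapping.lookup f \<alpha>) 0"
  by (simp add: specialize_def map.rep_eq when_def eval_at_zero)

lemma Fract_sum:
  fixes p :: "'c \<Rightarrow> 'b::idom"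
  shows "Fraction_Field.Fract (\<Sum>i\<in>I. p i) 1 = (\<Sum>i\<in>I. Fraction_Field.Fract (p i) 1)"
proof -
  have "Fraction_Field.Fract (a + b) 1 = Fraction_Field.Fract a 1 + Fraction_Field.Fract b 1"
    for a b :: "'b"
    by simp
  then show ?thesis
    by (induction I rule: infinite_finite_induct) (auto simp: fract_collapse simp del: add_fract)
qed

lemma obtain_common_denominator:
  fixes x :: "'i \<Rightarrow> 'a::idom fract"
  assumes "finite I"
  obtains q p where "q \<noteq> 0" "\<And>i. i \<in> I \<Longrightarrow> Fraction_Field.Fract q 1 * x i = Fraction_Field.Fract (p i) 1"
proof -
  have "\<exists>q\<noteq>0. \<forall>i\<in>I. \<exists>p. Fraction_Field.Fract q 1 * x i = Fraction_Field.Fract p 1"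
    using assms
  proof (induction I)
    case empty
    then show ?case by (intro exI[of _ 1]) simp
  next
    case (insert k I)
    then obtain q where q: "q \<noteq> 0" "\<forall>i\<in>I. \<exists>p. Fraction_Field.Fract q 1 * x i = Fraction_Field.Fract p 1"
      by blast
    obtain a b where k: "x k = Fraction_Field.Fract a b" "b \<noteq> 0"
      by (cases "x k" rule: Fract_cases)
    show ?case
    proof (rule exI[of _ "b * q"], intro conjI ballI)
      show "b * q \<noteq> 0" using q k by simp
      fix i assume "i \<in> insert k I"
      then consider "i = k" | "i \<in> I" by blast
      then show "\<exists>p. Fraction_Field.Fract (b * q) 1 * x i = Fraction_Field.Fract p 1"
      proof cases
        case 1
        have "Fraction_Field.Fract (b * q) 1 * x k = Fraction_Field.Fract (q * a) 1"
          using k by (simp add: eq_fract)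
        with 1 show ?thesis by blast
      next
        case 2
        then obtain p where p: "Fraction_Field.Fract q 1 * x i = Fraction_Field.Fract p 1"
          using q by blast
        have "Fraction_Field.Fract (b * q) 1 * x i
            = Fraction_Field.Fract b 1 * (Fraction_Field.Fract q 1 * x i)"
          by (simp add: mult.assoc[symmetric])
        also have "\<dots> = Fraction_Field.Fract (b * p) 1" by (simp add: p)
        finally show ?thesis by blast
      qed
    qed
  qed
  then obtain q where "q \<noteq> 0" "\<forall>i\<in>I. \<exists>p. Fraction_Field.Fract q 1 * x i = Fraction_Field.Fract p 1"
    by blast
  then show thesis using that by metis
qed

text \<open>
  A product has no other way to reach \<open>\<mu>\<close>: the factor from \<open>p\<close> already has total degree at least that
  of \<open>\<mu>\<close>.  Other terms of \<open>p\<close> of the same degree as \<open>\<mu>\<close> may exist; they cannot contribute to \<open>\<mu>\<close>.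
\<close>

lemma lookup_mult_lowest_degree:
  fixes p c :: "('n::finite, 'a::comm_ring_1) mpoly"
  assumes "\<And>\<alpha>. \<alpha> \<in> Poly_Mapping.keys p \<Longrightarrow> total_degree \<mu> \<le> total_degree \<alpha>"
  shows "Poly_Mapping.lookup (p * c) \<mu> = Poly_Mapping.lookup p \<mu> * Poly_Mapping.lookup c 0"
proof -
  have "Poly_Mapping.lookup (Poly_Mapping.single \<alpha> a * Poly_Mapping.single \<beta> b) \<mu>
      = (if \<alpha> = \<mu> \<and> \<beta> = 0 then a * b else 0)" if "\<alpha> \<in> Poly_Mapping.keys p" for \<alpha> \<beta> a b
  proof -
    have "\<alpha> + \<beta> = \<mu> \<longleftrightarrow> \<alpha> = \<mu> \<and> \<beta> = 0"
    proof
      assume eq: "\<alpha> + \<beta> = \<mu>"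
      then have "total_degree \<beta> = 0"
        using assms[OF that] total_degree_add[of \<alpha> \<beta>] by simp
      then have "\<beta> = 0" by (simp add: poly_mapping_eq_iff fun_eq_iff)
      with eq show "\<alpha> = \<mu> \<and> \<beta> = 0" by simp
    qed simp
    then show ?thesis by (simp add: mult_single lookup_single when_def)
  qed
  note monom = this
  have "Poly_Mapping.lookup (p * c) \<mu> = (\<Sum>\<alpha>\<in>Poly_Mapping.keys p. \<Sum>\<beta>\<in>Poly_Mapping.keys c.
      Poly_Mapping.lookup (Poly_Mapping.single \<alpha> (Poly_Mapping.lookup p \<alpha>) *
        Poly_Mapping.single \<beta> (Poly_Mapping.lookup c \<beta>)) \<mu>)"
    by (subst sum_of_terms[of p], subst sum_of_terms[of c]) (simp only: sum_product lookup_sum)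
  also have "\<dots> = (\<Sum>\<alpha>\<in>Poly_Mapping.keys p. \<Sum>\<beta>\<in>Poly_Mapping.keys c.
      if \<alpha> = \<mu> \<and> \<beta> = 0 then Poly_Mapping.lookup p \<alpha> * Poly_Mapping.lookup c \<beta> else 0)"
    by (intro sum.cong refl monom)
  also have "\<dots> = (\<Sum>\<alpha>\<in>Poly_Mapping.keys p. if \<alpha> = \<mu> then
      (\<Sum>\<beta>\<in>Poly_Mapping.keys c. if \<beta> = 0 then Poly_Mapping.lookup p \<alpha> * Poly_Mapping.lookup c \<beta> else 0) else 0)"
    by (intro sum.cong) auto
  also have "\<dots> = Poly_Mapping.lookup p \<mu> * Poly_Mapping.lookup c 0"
    by (simp add: in_keys_iff)
  finally show ?thesis .
qed

text \<open>
  The entries \<open>P\<close> are chosen for the special form and tested on the generic one: passing to lowest-degree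
  coefficients maps solutions to solutions and keeps both nonvanishing and the vanishing at \<open>P\<close>.
\<close>

lemma dim_M_set_generic_le:
  fixes f :: "('r::finite, ('n::{finite,linorder}, 'k::field) mpoly) dpring"
  shows "mat_dim (M_set (generic_form f)) \<le> mat_dim (M_set (specialize (\<lambda>_. 0) f))"
proof -
  let ?f0 = "specialize (\<lambda>_. 0) f"
  obtain B0 :: "('k ^ 'r ^ 'r) set" where "finite_dimensional_vector_space mat_scale B0"
    by (rule obtain_mat_basis)
  then interpret K: finite_dimensional_vector_space "mat_scale :: 'k \<Rightarrow> 'k ^ 'r ^ 'r \<Rightarrow> _" B0 .
  obtain Bt :: "(('n, 'k) mpoly fract ^ 'r ^ 'r) set" where "finite_dimensional_vector_space mat_scale Bt"
    by (rule obtain_mat_basis)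
  then interpret F: finite_dimensional_vector_space
    "mat_scale :: ('n, 'k) mpoly fract \<Rightarrow> ('n, 'k) mpoly fract ^ 'r ^ 'r \<Rightarrow> _" Bt .
  have "\<exists>P\<subseteq>UNIV. finite P \<and> card P \<le> K.dim (M_set ?f0) \<and>
    (\<forall>A\<in>M_set ?f0. (\<forall>k\<in>P. A $ fst k $ snd k = 0) \<longrightarrow> A = 0)"
    by (rule K.ex_separating_functionals, rule subspace_M_set, rule linear_mat_entry,
        rule mat_eq_0I, blast)
  then obtain P where P: "finite P" "card P \<le> K.dim (M_set ?f0)"
    "\<forall>A\<in>M_set ?f0. (\<forall>k\<in>P. A $ fst k $ snd k = 0) \<longrightarrow> A = 0"
    by (elim exE conjE)
  have "F.dim (M_set (generic_form f)) \<le> card P"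
  proof (rule F.dim_le_card_separating_functionals[of P _ "\<lambda>k A. A $ fst k $ snd k"])
    fix A assume A: "A \<in> M_set (generic_form f)" and A_P: "\<And>k. k \<in> P \<Longrightarrow> A $ fst k $ snd k = 0"
    show "A = 0"
    proof (rule ccontr)
      assume "A \<noteq> 0"
      obtain q p' where q: "q \<noteq> 0" and "\<And>k. k \<in> UNIV \<Longrightarrow>
          Fraction_Field.Fract q 1 * (case k of (i, j) \<Rightarrow> A $ i $ j) = Fraction_Field.Fract (p' k) 1"
        by (rule obtain_common_denominator[of UNIV "\<lambda>(i, j). A $ i $ j"]) auto
      then have "\<exists>p. \<forall>i j. Fraction_Field.Fract q 1 * A $ i $ j = Fraction_Field.Fract (p i j) 1"
        by (intro exI[of _ "\<lambda>i j. p' (i, j)"]) auto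
      then obtain p where
        p: "\<And>i j. Fraction_Field.Fract q 1 * A $ i $ j = Fraction_Field.Fract (p i j) 1" by blast
      have p_eq_0: "p i j = 0 \<longleftrightarrow> A $ i $ j = 0" for i j
      proof -
        have Fract_eq_0: "Fraction_Field.Fract a 1 = 0 \<longleftrightarrow> a = 0" for a :: "('n, 'k) mpoly"
          by (simp add: Zero_fract_def eq_fract)
        show ?thesis using p[of i j] q by (metis Fract_eq_0 mult_eq_0_iff)
      qed
      \<comment> \<open>One monomial serves all entries, so its coefficients form a nonzero matrix.\<close>
      define S where "S = (\<Union>(i, j)\<in>UNIV. Poly_Mapping.keys (p i j))"
      have "finite S" unfolding S_def by auto
      moreover have "S \<noteq> {}"
        using \<open>A \<noteq> 0\<close> by (auto simp: S_def vec_eq_iff simp flip: p_eq_0)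
      ultimately obtain \<mu> where \<mu>: "\<mu> \<in> S" "\<And>\<alpha>. \<alpha> \<in> S \<Longrightarrow> total_degree \<mu> \<le> total_degree \<alpha>"
        using arg_min_if_finite[of S total_degree] by (meson not_less)
      define C where "C = (\<chi> i j. Poly_Mapping.lookup (p i j) \<mu>)"
      have lowest: "Poly_Mapping.lookup (p i j * c) \<mu> = C $ i $ j * Poly_Mapping.lookup c 0" for i j c
        unfolding C_def by (subst lookup_mult_lowest_degree) (use \<mu>(2) in \<open>auto simp: S_def\<close>)
      have "C \<in> M_set ?f0"
        unfolding mem_M_set_iff
      proof (intro allI)
        fix i j \<gamma>
        have "Fraction_Field.Fract (\<Sum>k\<in>UNIV. p j k * Poly_Mapping.lookup f (\<gamma> + unit_exp i + unit_exp k)) 1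
          = Fraction_Field.Fract q 1 *
            (\<Sum>k\<in>UNIV. A $ j $ k * Poly_Mapping.lookup (generic_form f) (\<gamma> + unit_exp i + unit_exp k))"
          for i j
          by (simp add: Fract_sum lookup_generic_form sum_distrib_left p mult.assoc[symmetric])
        then have "Fraction_Field.Fract (\<Sum>k\<in>UNIV. p j k * Poly_Mapping.lookup f (\<gamma> + unit_exp i + unit_exp k)) 1
          = Fraction_Field.Fract (\<Sum>k\<in>UNIV. p i k * Poly_Mapping.lookup f (\<gamma> + unit_exp j + unit_exp k)) 1"
          using A by (simp add: mem_M_set_iff)
        then have "(\<Sum>k\<in>UNIV. p j k * Poly_Mapping.lookup f (\<gamma> + unit_exp i + unit_exp k))
          = (\<Sum>k\<in>UNIV. p i k * Poly_Mapping.lookup f (\<gamma> + unit_exp j + unit_exp k))"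
          by (simp add: eq_fract)
        then have "Poly_Mapping.lookup (\<Sum>k\<in>UNIV. p j k * Poly_Mapping.lookup f (\<gamma> + unit_exp i + unit_exp k)) \<mu>
          = Poly_Mapping.lookup (\<Sum>k\<in>UNIV. p i k * Poly_Mapping.lookup f (\<gamma> + unit_exp j + unit_exp k)) \<mu>"
          by simp
        then show "(\<Sum>k\<in>UNIV. C $ j $ k * Poly_Mapping.lookup ?f0 (\<gamma> + unit_exp i + unit_exp k)) =
          (\<Sum>k\<in>UNIV. C $ i $ k * Poly_Mapping.lookup ?f0 (\<gamma> + unit_exp j + unit_exp k))"
          by (simp add: lookup_sum lowest lookup_specialize_zero)
      qed
      moreover have "C $ fst k $ snd k = 0" if "k \<in> P" for k
        using A_P[OF that] p_eq_0[of "fst k" "snd k"] by (simp add: C_def)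
      ultimately have "C = 0" using P(3) by simp
      moreover obtain i j where "\<mu> \<in> Poly_Mapping.keys (p i j)" using \<mu>(1) by (auto simp: S_def)
      ultimately show False by (auto simp: C_def vec_eq_iff in_keys_iff)
    qed
  qed (auto simp: P(1) subspace_M_set linear_mat_entry)
  with P(2) show ?thesis by (simp add: mat_dim_def)
qed

section \<open>Projections from regular splittings\<close>

text \<open>
  Bases of \<open>V\<close> and \<open>U\<close> together span \<open>V + U\<close> and have no more than \<open>dim (V + U) = dim V + dim U\<close>
  elements, so they are independent and a linear map can be prescribed on both.
\<close>

lemma obtain_projection_matrix:
  fixes V U :: "('a::field ^ 'r::finite) set"
  assumes "vec.subspace V" "vec.subspace U" "V \<inter> U = {0}"
  obtains A where "\<And>v. v \<in> V \<Longrightarrow> A *v v = v" "\<And>u. u \<in> U \<Longrightarrow> A *v u = 0"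
proof -
  obtain B where B: "B \<subseteq> V" "vec.independent B" "V \<subseteq> vec.span B" "card B = vec.dim V"
    by (rule vec.basis_exists)
  obtain C where C: "C \<subseteq> U" "vec.independent C" "U \<subseteq> vec.span C" "card C = vec.dim U"
    by (rule vec.basis_exists)
  let ?W = "{x + y |x y. x \<in> V \<and> y \<in> U}"
  have fin: "finite B" "finite C"
    using B(2) C(2) by (simp_all add: vec.finiteI_independent)
  have "vec.independent (B \<union> C)"
  proof (rule vec.card_le_dim_spanning)
    show "B \<union> C \<subseteq> ?W"
      using B(1) C(1) vec.subspace_0[OF assms(1)] vec.subspace_0[OF assms(2)] by force
    show "?W \<subseteq> vec.span (B \<union> C)"
      using B(3) C(3) unfolding vec.span_Un by blast
    have "vec.dim ?W = vec.dim V + vec.dim U"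
      using vec.dim_sums_Int[OF assms(1,2)] assms(3) by simp
    then show "card (B \<union> C) \<le> vec.dim ?W"
      using card_Un_le[of B C] B(4) C(4) by simp
  qed (use fin in simp)
  then obtain g where g: "Vector_Spaces.linear (*s) (*s) g"
    "\<And>x. x \<in> B \<union> C \<Longrightarrow> g x = (if x \<in> B then x else 0)"
    using vec.linear_independent_extend[of "B \<union> C" "\<lambda>x. if x \<in> B then x else 0"] by blast
  interpret g: Vector_Spaces.linear "(*s)" "(*s)" g by (rule g(1))
  have "B \<inter> C = {}"
  proof -
    have "0 \<notin> B" using B(2) vec.dependent_zero by blast
    moreover have "x = 0" if "x \<in> B" "x \<in> C" for x
    proof -
      have "x \<in> V \<inter> U" using that B(1) C(1) by auto
      then show ?thesis using assms(3) by simp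
    qed
    ultimately show ?thesis by auto
  qed
  have "g v = v" if "v \<in> V" for v
  proof -
    have "v \<in> vec.span B" using that B(3) by auto
    then show ?thesis
    proof (rule vec.span_induct)
      show "vec.subspace {x. g x = x}" by (simp add: vec.subspace_def g.add g.scale)
    qed (simp add: g(2))
  qed
  moreover have "g u = 0" if "u \<in> U" for u
  proof -
    have "u \<in> vec.span C" using that C(3) by auto
    then show ?thesis
    proof (rule vec.span_induct)
      show "vec.subspace {x. g x = 0}" by (simp add: vec.subspace_def g.add g.scale)
      show "g x = 0" if "x \<in> C" for x
        using that \<open>B \<inter> C = {}\<close> g(2)[of x] by auto
    qed
  qed
  ultimately show thesis
    using that[of "matrix g"] by (simp add: matrix_works[OF g(1)])
qed

lemma forms_add: "f \<in> forms d \<Longrightarrow> g \<in> forms d \<Longrightarrow> f + g \<in> forms d"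
  using keys_add[of f g] by (auto simp: forms_def)

lemma forms_zero: "0 \<in> forms d"
  by (simp add: forms_def)

lemma forms_sum: "(\<And>i. i \<in> I \<Longrightarrow> f i \<in> forms d) \<Longrightarrow> (\<Sum>i\<in>I. f i) \<in> forms d"
  by (induction I rule: infinite_finite_induct) (auto simp: forms_zero forms_add)

lemma lookup_forms_eq_0: "f \<in> forms d \<Longrightarrow> total_degree \<alpha> \<noteq> d \<Longrightarrow> Poly_Mapping.lookup f \<alpha> = 0"
  by (auto simp: forms_def in_keys_iff)

lemma single_in_forms: "total_degree \<alpha> = d \<Longrightarrow> Poly_Mapping.single \<alpha> c \<in> forms d"
  by (simp add: forms_def)

lemma act_in_forms:
  assumes "D \<in> forms e" "f \<in> forms (e + d)"
  shows "act D f \<in> forms d"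
proof -
  have "total_degree \<gamma> = d" if "Poly_Mapping.lookup (act D f) \<gamma> \<noteq> 0" for \<gamma>
  proof -
    have "\<exists>\<beta>\<in>Poly_Mapping.keys D. Poly_Mapping.lookup f (\<gamma> + \<beta>) \<noteq> 0"
    proof (rule ccontr)
      assume "\<not> ?thesis"
      then have "Poly_Mapping.lookup (act D f) \<gamma> = 0" by (simp add: lookup_act)
      with that show False by simp
    qed
    then obtain \<beta> where \<beta>: "\<beta> \<in> Poly_Mapping.keys D" "Poly_Mapping.lookup f (\<gamma> + \<beta>) \<noteq> 0"
      by blast
    then have "total_degree (\<gamma> + \<beta>) = e + d"
      using lookup_forms_eq_0[OF assms(2)] by blast
    moreover have "total_degree \<beta> = e"
      using \<beta>(1) assms(1) by (simp add: forms_def)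
    ultimately show ?thesis by (simp add: total_degree_add)
  qed
  then show ?thesis by (simp add: forms_def in_keys_iff)
qed

lemma derivs_add: "h \<in> derivs e f \<Longrightarrow> h' \<in> derivs e f \<Longrightarrow> h + h' \<in> derivs e f"
  by (auto simp: derivs_def simp flip: act_add intro: forms_add)

lemma derivs_zero: "0 \<in> derivs e f"
  unfolding derivs_def using act_zero forms_zero by (metis (mono_tags, lifting) mem_Collect_eq)

lemma derivs_scale: "h \<in> derivs e f \<Longrightarrow> dp_scale c h \<in> derivs e f"
proof -
  assume "h \<in> derivs e f"
  then obtain D where D: "D \<in> forms e" "h = act D f" by (auto simp: derivs_def)
  have "dp_scale c h = act (dp_scale c D) f"
    by (rule poly_mapping_eqI, subst lookup_act_superset[of "Poly_Mapping.keys D"])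
      (auto simp: D(2) lookup_dp_scale lookup_act sum_distrib_left mult.assoc in_keys_iff)
  moreover have "dp_scale c D \<in> forms e"
    using D(1) by (auto simp: forms_def in_keys_iff lookup_dp_scale)
  ultimately show ?thesis by (auto simp: derivs_def)
qed

text \<open>
  The coordinates of a linear form with respect to \<open>x\<^sub>1, \<dots>, x\<^sub>r\<close>, by which matrices act on linear forms.
\<close>

definition coord_vec :: "('r, 'a::comm_ring_1) dpring \<Rightarrow> 'a ^ 'r::finite" where
  "coord_vec h = (\<chi> k. Poly_Mapping.lookup h (unit_exp k))"

lemma coord_vec_add: "coord_vec (h + h') = coord_vec h + coord_vec h'"
  by (simp add: coord_vec_def vec_eq_iff lookup_add)

lemma coord_vec_zero: "coord_vec 0 = 0"
  by (simp add: coord_vec_def vec_eq_iff)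

lemma coord_vec_scale: "coord_vec (dp_scale c h) = c *s coord_vec h"
  by (simp add: coord_vec_def vec_eq_iff lookup_dp_scale)

lemma total_degree_1E:
  assumes "total_degree \<alpha> = 1"
  obtains k where "\<alpha> = unit_exp k"
proof -
  obtain k where k: "Poly_Mapping.lookup \<alpha> k = 1" "\<forall>j\<in>UNIV. k \<noteq> j \<longrightarrow> Poly_Mapping.lookup \<alpha> j = 0"
    using iffD1[OF sum_eq_1_iff[OF finite] assms] by (elim bexE conjE)
  then have "\<alpha> = unit_exp k"
    by (intro poly_mapping_eqI) (auto simp: lookup_single when_def)
  then show thesis by (rule that)
qed

lemma coord_vec_inject:
  assumes "h \<in> forms 1" "h' \<in> forms 1" "coord_vec h = coord_vec h'"
  shows "h = h'"
proof (rule poly_mapping_eqI)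
  fix \<alpha>
  show "Poly_Mapping.lookup h \<alpha> = Poly_Mapping.lookup h' \<alpha>"
  proof (cases "total_degree \<alpha> = 1")
    case True
    then obtain k where "\<alpha> = unit_exp k" by (rule total_degree_1E)
    then show ?thesis using assms(3) by (simp add: coord_vec_def vec_eq_iff)
  next
    case False
    then show ?thesis using lookup_forms_eq_0 assms(1,2) by metis
  qed
qed

lemma subspace_coord_vec_image:
  assumes "0 \<in> S" "\<And>h h'. h \<in> S \<Longrightarrow> h' \<in> S \<Longrightarrow> h + h' \<in> S" "\<And>c h. h \<in> S \<Longrightarrow> dp_scale c h \<in> S"
  shows "vec.subspace (coord_vec ` S :: ('a::field ^ 'r::finite) set)"
proof (rule vec.subspaceI)
  show "(0 :: 'a ^ 'r) \<in> coord_vec ` S"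
    using assms(1) coord_vec_zero by (metis image_eqI)
  show "x + y \<in> coord_vec ` S" if "x \<in> coord_vec ` S" "y \<in> coord_vec ` S" for x y :: "'a ^ 'r"
    using that assms(2) by (auto simp flip: coord_vec_add)
  show "c *s x \<in> coord_vec ` S" if "x \<in> coord_vec ` S" for c and x :: "'a ^ 'r"
    using that assms(3) by (auto simp flip: coord_vec_scale)
qed

lemma dp_scale_sum: "dp_scale c (\<Sum>i\<in>I. h i) = (\<Sum>i\<in>I. dp_scale c (h i))"
  by (rule poly_mapping_eqI) (simp add: lookup_dp_scale lookup_sum sum_distrib_left)

text \<open>
  The degree is written \<open>Suc e\<close> so that the derivatives of order \<open>e\<close> are linear forms.
\<close>

lemma card_le_dim_M_set_of_splitting:
  fixes g :: "'i \<Rightarrow> ('r::finite, 'a::field) dpring"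
  assumes "finite I"
    and forms: "\<And>i. i \<in> I \<Longrightarrow> g i \<in> forms (Suc e)"
    and nonzero: "\<And>i. i \<in> I \<Longrightarrow> g i \<noteq> 0"
    and direct: "\<And>i. i \<in> I \<Longrightarrow> derivs e (g i) \<inter>
      {\<Sum>j\<in>I - {i}. h j | h. \<forall>j\<in>I - {i}. h j \<in> derivs e (g j)} = {0}"
  shows "card I \<le> mat_dim (M_set (\<Sum>i\<in>I. g i))"
proof -
  obtain B :: "('a ^ 'r ^ 'r) set" where "finite_dimensional_vector_space mat_scale B"
    by (rule obtain_mat_basis)
  then interpret M: finite_dimensional_vector_space "mat_scale :: 'a \<Rightarrow> 'a ^ 'r ^ 'r \<Rightarrow> _" B .
  define V where "V i = coord_vec ` derivs e (g i)" for i
  define S where "S i = {\<Sum>j\<in>I - {i}. h j | h. \<forall>j\<in>I - {i}. h j \<in> derivs e (g j)}" for i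
  have derivs_forms: "h \<in> forms 1" if "i \<in> I" "h \<in> derivs e (g i)" for i h
    using that forms[OF that(1)] by (auto simp: derivs_def intro!: act_in_forms[of _ e])
  have V: "vec.subspace (V i)" for i
    unfolding V_def by (intro subspace_coord_vec_image derivs_zero derivs_add derivs_scale)
  have S: "vec.subspace (coord_vec ` S i)" for i
  proof (rule subspace_coord_vec_image)
    show "0 \<in> S i"
      unfolding S_def by (intro CollectI exI[of _ "\<lambda>_. 0"]) (simp add: derivs_zero)
    show "h + h' \<in> S i" if "h \<in> S i" "h' \<in> S i" for h h'
    proof -
      obtain u u' where "h = (\<Sum>j\<in>I - {i}. u j)" "\<forall>j\<in>I - {i}. u j \<in> derivs e (g j)"
        "h' = (\<Sum>j\<in>I - {i}. u' j)" "\<forall>j\<in>I - {i}. u' j \<in> derivs e (g j)"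
        using \<open>h \<in> S i\<close> \<open>h' \<in> S i\<close> unfolding S_def by blast
      then show ?thesis
        unfolding S_def
        by (intro CollectI exI[of _ "\<lambda>j. u j + u' j"]) (simp add: sum.distrib derivs_add)
    qed
    show "dp_scale c h \<in> S i" if "h \<in> S i" for c h
    proof -
      obtain u where "h = (\<Sum>j\<in>I - {i}. u j)" "\<forall>j\<in>I - {i}. u j \<in> derivs e (g j)"
        using \<open>h \<in> S i\<close> unfolding S_def by blast
      then show ?thesis
        unfolding S_def
        by (intro CollectI exI[of _ "\<lambda>j. dp_scale c (u j)"]) (simp add: dp_scale_sum derivs_scale)
    qed
  qed
  have direct': "V i \<inter> coord_vec ` S i = {0}" if i: "i \<in> I" for i
  proof -
    have "x = 0" if "x \<in> V i" "x \<in> coord_vec ` S i" for x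
    proof -
      obtain h where h: "h \<in> derivs e (g i)" "x = coord_vec h"
        using \<open>x \<in> V i\<close> by (auto simp: V_def)
      obtain h' where h': "h' \<in> S i" "x = coord_vec h'"
        using \<open>x \<in> coord_vec ` S i\<close> by auto
      obtain u where "h' = (\<Sum>j\<in>I - {i}. u j)" "\<forall>j\<in>I - {i}. u j \<in> derivs e (g j)"
        using h'(1) unfolding S_def by blast
      then have "h' \<in> forms 1"
        by (metis DiffD1 derivs_forms forms_sum)
      then have "h = h'"
        using h h' derivs_forms[OF i h(1)] by (intro coord_vec_inject) auto
      then have "h = 0"
        using direct[OF i] h(1) h'(1) unfolding S_def by blast
      then show ?thesis using h(2) by (simp add: coord_vec_zero)
    qed
    then show ?thesis
      using vec.subspace_0[OF V] vec.subspace_0[OF S] by blast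
  qed
  have V_subset: "V j \<subseteq> coord_vec ` S i" if "j \<in> I" "j \<noteq> i" for i j
  proof
    fix x assume "x \<in> V j"
    then obtain h where h: "h \<in> derivs e (g j)" "x = coord_vec h"
      by (auto simp: V_def)
    have "h = (\<Sum>k\<in>I - {i}. if k = j then h else 0)"
      using that \<open>finite I\<close> by simp
    then have "h \<in> S i"
      unfolding S_def using h(1) derivs_zero
      by (intro CollectI exI[of _ "\<lambda>k. if k = j then h else 0"]) auto
    then show "x \<in> coord_vec ` S i" using h(2) by blast
  qed
  have "\<exists>A. (\<forall>v\<in>V i. A *v v = v) \<and> (\<forall>u\<in>coord_vec ` S i. A *v u = 0)" if "i \<in> I" for i
    using obtain_projection_matrix[OF V S direct'[OF that]] by metis
  then obtain A where
    A_id: "\<And>i v. i \<in> I \<Longrightarrow> v \<in> V i \<Longrightarrow> A i *v v = v" and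
    A_S: "\<And>i u. i \<in> I \<Longrightarrow> u \<in> coord_vec ` S i \<Longrightarrow> A i *v u = 0"
    by metis
  have A_0: "A i *v v = 0" if "i \<in> I" "j \<in> I" "j \<noteq> i" "v \<in> V j" for i j v
    using A_S V_subset that by blast

  \<comment> \<open>The linear form \<open>\<partial>\<^sup>\<gamma>f\<close> when \<open>\<gamma>\<close> has degree \<open>e\<close>; in other degrees the vector is zero for forms of degree \<open>Suc e\<close>, so that the following facts hold for every \<open>\<gamma>\<close>.\<close>
  define grad :: "('r, 'a) dpring \<Rightarrow> ('r \<Rightarrow>\<^sub>0 nat) \<Rightarrow> 'a ^ 'r" where
    "grad f \<gamma> = (\<chi> k. Poly_Mapping.lookup f (\<gamma> + unit_exp k))" for f \<gamma>
  have grad_V: "grad (g j) \<gamma> \<in> V j" if "j \<in> I" for j \<gamma>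
  proof (cases "total_degree \<gamma> = e")
    case True
    then have "act (Poly_Mapping.single \<gamma> 1) (g j) \<in> derivs e (g j)"
      by (auto simp: derivs_def intro: single_in_forms)
    moreover have "coord_vec (act (Poly_Mapping.single \<gamma> 1) (g j)) = grad (g j) \<gamma>"
      by (simp add: coord_vec_def grad_def lookup_act_single add.commute)
    ultimately show ?thesis unfolding V_def by (metis image_eqI)
  next
    case False
    then have "total_degree (\<gamma> + unit_exp k) \<noteq> Suc e" for k
      unfolding total_degree_add total_degree_unit_exp by simp
    then have "grad (g j) \<gamma> = 0"
      by (simp add: grad_def vec_eq_iff lookup_forms_eq_0[OF forms[OF that]])
    then show ?thesis using vec.subspace_0[OF V] by simp
  qed
  \<comment> \<open>Coefficientwise, \<open>(A\<^sub>i\<partial>)f = \<partial>g\<^sub>i\<close>.\<close>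
  have A_grad: "A i *v grad (\<Sum>j\<in>I. g j) \<gamma> = grad (g i) \<gamma>" if "i \<in> I" for i \<gamma>
  proof -
    have "grad (\<Sum>j\<in>I. g j) \<gamma> = (\<Sum>j\<in>I. grad (g j) \<gamma>)"
      by (simp add: grad_def vec_eq_iff lookup_sum)
    then have "A i *v grad (\<Sum>j\<in>I. g j) \<gamma> = (\<Sum>j\<in>I. A i *v grad (g j) \<gamma>)"
      by (simp add: vec.sum)
    also have "\<dots> = (\<Sum>j\<in>I. if j = i then grad (g i) \<gamma> else 0)"
      by (intro sum.cong) (auto simp: A_id A_0 grad_V that)
    finally show ?thesis using that \<open>finite I\<close> by simp
  qed
  have A_M: "A i \<in> M_set (\<Sum>j\<in>I. g j)" if "i \<in> I" for i
    unfolding mem_M_set_iff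
  proof (intro allI)
    fix a b \<gamma>
    have eq: "(\<Sum>k\<in>UNIV. A i $ b $ k * Poly_Mapping.lookup (\<Sum>j\<in>I. g j) (\<gamma> + unit_exp a + unit_exp k))
      = Poly_Mapping.lookup (g i) (\<gamma> + unit_exp a + unit_exp b)" for a b
      using arg_cong[OF A_grad[OF that, of "\<gamma> + unit_exp a"], of "\<lambda>v. v $ b"]
      by (simp add: matrix_vector_mult_def grad_def)
    then show "(\<Sum>k\<in>UNIV. A i $ b $ k * Poly_Mapping.lookup (\<Sum>j\<in>I. g j) (\<gamma> + unit_exp a + unit_exp k))
      = (\<Sum>k\<in>UNIV. A i $ a $ k * Poly_Mapping.lookup (\<Sum>j\<in>I. g j) (\<gamma> + unit_exp b + unit_exp k))"
      unfolding eq by (simp only: add.assoc add.commute[of "unit_exp a"])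
  qed

  \<comment> \<open>Lowering a monomial of \<open>g\<^sub>i\<close> to a single variable gives a nonzero linear form.\<close>
  have V_nonzero: "\<exists>v\<in>V i. v \<noteq> 0" if i: "i \<in> I" for i
  proof -
    obtain \<alpha> where \<alpha>: "Poly_Mapping.lookup (g i) \<alpha> \<noteq> 0"
      using nonzero[OF i] by (metis lookup_zero poly_mapping_eqI)
    then have "total_degree \<alpha> = Suc e"
      using lookup_forms_eq_0[OF forms[OF i]] by metis
    then obtain k where k: "Poly_Mapping.lookup \<alpha> k \<noteq> 0"
      by (metis Zero_not_Suc sum.neutral)
    have "\<alpha> - unit_exp k + unit_exp k = \<alpha>"
      by (rule poly_mapping_eqI) (use k in \<open>auto simp: lookup_add lookup_minus lookup_single when_def\<close>)
    then have "grad (g i) (\<alpha> - unit_exp k) $ k \<noteq> 0"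
      using \<alpha> by (simp add: grad_def)
    then have "grad (g i) (\<alpha> - unit_exp k) \<noteq> 0" by (metis zero_index)
    then show ?thesis using grad_V[OF i] by auto
  qed
  \<comment> \<open>A nonzero vector of \<open>V\<^sub>i\<close> is killed by every other projection but fixed by \<open>A\<^sub>i\<close>.\<close>
  have A_notin_span: "A i \<notin> M.span (A ` (I - {i}))" if i: "i \<in> I" for i
  proof
    assume in_span: "A i \<in> M.span (A ` (I - {i}))"
    obtain v where v: "v \<in> V i" "v \<noteq> 0" using V_nonzero[OF i] by blast
    have scale_v: "mat_scale c X *v v = c *s (X *v v)" for c X
      by (simp add: mat_scale_def matrix_vector_mult_def vec_eq_iff sum_distrib_left mult.assoc)
    have "A i *v v = 0"
      using in_span
    proof (rule M.span_induct)
      show "M.subspace {X. X *v v = 0}"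
        by (auto simp: M.subspace_def matrix_vector_mult_add_rdistrib scale_v)
    qed (use A_0 v(1) i in auto)
    then show False using A_id[OF i v(1)] v(2) by simp
  qed
  have "inj_on A I"
  proof (rule inj_onI, rule ccontr)
    fix i j assume "i \<in> I" "j \<in> I" "A i = A j" "i \<noteq> j"
    then show False using A_notin_span[of i] M.span_base[of "A j" "A ` (I - {i})"] by auto
  qed
  have "M.independent (A ` I)"
    unfolding M.dependent_def
  proof safe
    fix i assume i: "i \<in> I" and "A i \<in> M.span (A ` I - {A i})"
    moreover have "A ` I - {A i} \<subseteq> A ` (I - {i})" by blast
    ultimately show False using A_notin_span[OF i] M.span_mono by blast
  qed
  then have "card (A ` I) \<le> M.dim (M_set (\<Sum>j\<in>I. g j))"
    using A_M by (intro M.independent_card_le_dim) auto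
  then show ?thesis
    using card_image[OF \<open>inj_on A I\<close>] by (simp add: mat_dim_def)
qed

lemma splits_regularly_le_dim_M_set:
  assumes "d \<ge> 1" "splits_regularly d m f"
  shows "m + 1 \<le> mat_dim (M_set f)"
proof -
  obtain e where d: "d = Suc e" using assms(1) by (cases d) auto
  obtain g where g: "f = (\<Sum>i\<in>{1..m+1}. g i)" "\<forall>i\<in>{1..m+1}. g i \<in> forms (Suc e) \<and> g i \<noteq> 0 \<and>
    derivs e (g i) \<inter> {\<Sum>j\<in>{1..m+1} - {i}. h j | h. \<forall>j\<in>{1..m+1} - {i}. h j \<in> derivs e (g j)} = {0}"
    using assms(2) unfolding splits_regularly_def d diff_Suc_1 by blast
  then have "card {1..m+1} \<le> mat_dim (M_set (\<Sum>i\<in>{1..m+1}. g i))"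
    by (intro card_le_dim_M_set_of_splitting[of _ _ e]) blast+
  then show ?thesis by (simp add: g(1))
qed

theorem lemma4p2:
  fixes d :: nat
    and ft :: "('r::finite, ('n::{finite,linorder}, 'k::field) mpoly) dpring"
    and f0 :: "('r, 'k) dpring"
  assumes "d \<ge> 1"
    and "ft \<in> forms d"
    and "f0 = specialize (\<lambda>_. 0) ft"
  shows "mat_dim (M_set (generic_form ft)) \<le> mat_dim (M_set f0) \<and>
    (\<forall>m. splits_regularly d m (generic_form ft) \<longrightarrow> int m \<le> int (mat_dim (M_set f0)) - 1)"
proof -
  have le: "mat_dim (M_set (generic_form ft)) \<le> mat_dim (M_set f0)"
    unfolding assms(3) by (rule dim_M_set_generic_le)
  moreover have "int m \<le> int (mat_dim (M_set f0)) - 1"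
    if "splits_regularly d m (generic_form ft)" for m
    using splits_regularly_le_dim_M_set[OF assms(1) that] le by simp
  ultimately show ?thesis by blast
qed

end
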